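(* Let $\lambda>0$ and let $d\geq 1$ be an integer, both arbitrary, and let $(a_n)_{n=0}^{\infty}\subset S^d$ be a greedy $\lambda$-energy sequence. For $n\geq 1$ let $U_n(x)=\sum_{j=0}^{n-1}|x-a_j|^{\lambda}$, $x\in S^d$. For any odd index $n=2k+1$, $k\geq 0$, the function $U_n$ attains its maximum value on $S^d$ at a unique point, which is $-a_{n-1}=-a_{2k}$; i.e., we have $$a_{2k+1}=-a_{2k}\qquad\text{for all } k\geq 0.$$ For any even index $n=2k\geq 2$, we have $$U_{2k}(x)=U_{2k}(-x)\qquad\text{for all } x\in S^d.$$
   Context: $S^d=\{x\in\mathbb{R}^{d+1}:|x|=1\}$, where $|\cdot|$ is the Euclidean norm. For $\lambda>0$, a greedy $\lambda$-energy sequence on $S^d$ is a sequence $(a_n)_{n=0}^{\infty}\subset S^d$ such that $\sum_{k=0}^{n-1}|a_n-a_k|^{\lambda}=\max_{x\in S^d}\sum_{k=0}^{n-1}|x-a_k|^{\lambda}$ for all $n\geq 1$ (the choice of $a_n$ need not be unique). *)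

theory Defs
  imports "HOL-Analysis.Analysis"
begin

text \<open>The sphere \<open>S^d\<close> is \<open>sphere 0 1 :: (real ^ 'n) set\<close> with \<open>CARD('n) = d + 1\<close>.\<close>

definition riesz_potential :: "real \<Rightarrow> (nat \<Rightarrow> real ^ 'n) \<Rightarrow> nat \<Rightarrow> real ^ 'n \<Rightarrow> real" where
  "riesz_potential l a n x = (\<Sum>j<n. norm (x - a j) powr l)"

definition maximizer_on_sphere :: "(real ^ 'n \<Rightarrow> real) \<Rightarrow> real ^ 'n \<Rightarrow> bool" where
  "maximizer_on_sphere f x \<longleftrightarrow> x \<in> sphere 0 1 \<and> (\<forall>y\<in>sphere 0 1. f y \<le> f x)"

definition greedy_energy_sequence :: "real \<Rightarrow> (nat \<Rightarrow> real ^ 'n) \<Rightarrow> bool" where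
  "greedy_energy_sequence l a \<longleftrightarrow>
     (\<forall>n. a n \<in> sphere 0 1) \<and>
     (\<forall>n\<ge>1. maximizer_on_sphere (riesz_potential l a n) (a n))"

end

theory Submission
  imports Defs
begin

text \<open>
  As long as the first \<open>2 * k\<close> points split into consecutive antipodal pairs, the potential
  \<open>U\<close> that they generate is even. The greedy choice makes \<open>a (2 * k)\<close> a maximizer of \<open>U\<close> on the
  sphere, hence \<open>- a (2 * k)\<close> is one as well. The next potential is
  \<open>U x + norm (x - a (2 * k)) powr l\<close>, and its second summand has the antipode \<open>- a (2 * k)\<close> as its
  only maximizer, since no other point of the sphere is a diameter away from \<open>a (2 * k)\<close>. Both
  summands are thus largest at \<open>- a (2 * k)\<close>, the second one only there, which forces
  \<open>a (2 * k + 1) = - a (2 * k)\<close>: one more antipodal pair, and the induction continues. It starts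
  from the empty potential \<open>0\<close>, for which every point of the sphere is a maximizer.
\<close>

text \<open>The parallelogram law \<open>(norm (x - p))\<^sup>2 + (norm (x + p))\<^sup>2 = 4\<close> leaves room for a distance of
  \<open>2\<close> only when \<open>x + p\<close> vanishes.\<close>

lemma dist_less_antipodal_dist:
  fixes x p :: "'a::real_inner"
  assumes "norm x = 1" "norm p = 1" "x \<noteq> - p"
  shows "norm (x - p) < norm (- p - p)"
proof -
  have "(norm (x - p))\<^sup>2 < (norm (x - p))\<^sup>2 + (norm (x + p))\<^sup>2"
    using assms(3) by (simp add: eq_neg_iff_add_eq_0)
  also have "\<dots> = 2 * ((norm x)\<^sup>2 + (norm p)\<^sup>2)"
    by (simp add: power2_norm_eq_inner inner_simps inner_commute)
  also have "\<dots> = 2\<^sup>2"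
    using assms(1,2) by simp
  finally have "norm (x - p) < 2"
    by (rule power2_less_imp_less) simp
  also have "2 = norm (- p - p)"
  proof -
    have "- p - p = (- 2) *\<^sub>R p" by (simp add: scaleR_2)
    thus ?thesis using assms(2) by (simp only: norm_scaleR)
  qed
  finally show ?thesis .
qed

lemma riesz_potential_Suc:
  "riesz_potential l a (Suc n) x = riesz_potential l a n x + norm (x - a n) powr l"
  by (simp add: riesz_potential_def)

text \<open>The reflection \<open>x \<mapsto> - x\<close> exchanges the two summands coming from an antipodal pair.\<close>

lemma riesz_potential_antipodal_pairs_even:
  assumes "\<And>j. j < k \<Longrightarrow> a (2 * j + 1) = - a (2 * j)"
  shows "riesz_potential l a (2 * k) (- x) = riesz_potential l a (2 * k) x"
  using assms
proof (induction k)
  case 0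
  show ?case by (simp add: riesz_potential_def)
next
  case (Suc k)
  have "norm (- x - a (2 * k)) = norm (x + a (2 * k))"
    using norm_minus_cancel[of "x + a (2 * k)"] by simp
  moreover have "norm (- x + a (2 * k)) = norm (x - a (2 * k))"
    using norm_minus_cancel[of "x - a (2 * k)"] by simp
  ultimately show ?case
    using Suc.IH Suc.prems[of k] Suc.prems
    by (simp add: riesz_potential_Suc)
qed

text \<open>The step from an even to an odd number of points: the symmetry carries the maximizer \<open>p\<close>
  of \<open>f\<close> over to \<open>- p\<close>, the one point where the new summand is largest.\<close>

lemma maximizer_on_sphere_even_plus_distance:
  fixes f :: "real ^ 'n \<Rightarrow> real"
  assumes "l > 0"
    and even: "\<And>x. f (- x) = f x"
    and max: "maximizer_on_sphere f p"
  shows "maximizer_on_sphere (\<lambda>x. f x + norm (x - p) powr l) x \<longleftrightarrow> x = - p"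
proof -
  let ?g = "\<lambda>x. f x + norm (x - p) powr l"
  have p: "norm p = 1"
    using max by (simp add: maximizer_on_sphere_def)
  have strict: "?g y < ?g (- p)" if "norm y = 1" "y \<noteq> - p" for y
  proof -
    have "f y \<le> f (- p)"
      using max that(1) by (simp add: maximizer_on_sphere_def even)
    moreover have "norm (y - p) powr l < norm (- p - p) powr l"
      using dist_less_antipodal_dist[OF that(1) p that(2)] \<open>l > 0\<close>
      by (intro powr_less_mono2) auto
    ultimately show ?thesis by simp
  qed
  have le: "?g y \<le> ?g (- p)" if "norm y = 1" for y
    using strict[OF that] by (cases "y = - p") auto
  show ?thesis
  proof
    assume "maximizer_on_sphere ?g x"
    moreover have "- p \<in> sphere 0 1"
      using p by simp
    ultimately have "norm x = 1" "?g (- p) \<le> ?g x"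
      unfolding maximizer_on_sphere_def by (simp, blast)
    thus "x = - p" using strict[of x] by force
  next
    assume "x = - p"
    thus "maximizer_on_sphere ?g x"
      using p le by (simp add: maximizer_on_sphere_def)
  qed
qed

theorem theorem2p1:
  fixes l :: real and d :: nat and a :: "nat \<Rightarrow> real ^ 'n"
  assumes "l > 0"
    and "d \<ge> 1"
    and "CARD('n) = d + 1"
    and "greedy_energy_sequence l a"
  shows "(\<forall>k. {x. maximizer_on_sphere (riesz_potential l a (2 * k + 1)) x} = {- a (2 * k)} \<and>
              a (2 * k + 1) = - a (2 * k)) \<and>
         (\<forall>k\<ge>1. \<forall>x\<in>sphere 0 1.
              riesz_potential l a (2 * k) x = riesz_potential l a (2 * k) (- x))"
proof -
  let ?U = "riesz_potential l a"
  have greedy: "maximizer_on_sphere (?U n) (a n)" for n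
  proof (cases n)
    \<comment> \<open>The greedy condition leaves \<open>a 0\<close> free, but the empty potential is constant.\<close>
    case 0
    thus ?thesis using assms(4)
      by (auto simp: greedy_energy_sequence_def maximizer_on_sphere_def riesz_potential_def)
  next
    case (Suc m)
    thus ?thesis using assms(4) by (auto simp: greedy_energy_sequence_def)
  qed
  have maximizers: "maximizer_on_sphere (?U (2 * k + 1)) x \<longleftrightarrow> x = - a (2 * k)"
    if "\<And>j. j < k \<Longrightarrow> a (2 * j + 1) = - a (2 * j)" for k x
  proof -
    have "?U (2 * k + 1) = (\<lambda>x. ?U (2 * k) x + norm (x - a (2 * k)) powr l)"
      by (simp add: riesz_potential_Suc fun_eq_iff)
    thus ?thesis
      using maximizer_on_sphere_even_plus_distance[OF \<open>l > 0\<close> _ greedy]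
        riesz_potential_antipodal_pairs_even[OF that] by simp
  qed
  have antipodal: "a (2 * k + 1) = - a (2 * k)" for k
    by (induction k rule: less_induct) (use maximizers greedy in blast)
  show ?thesis
    using maximizers antipodal riesz_potential_antipodal_pairs_even[OF antipodal] by auto
qed

end
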